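(* Let $\mathcal{H}_1,\mathcal{H}_2$ be complex separable Hilbert spaces, let $A:\operatorname{dom}(A)\subseteq\mathcal{H}_1\to\mathcal{H}_2$ be a densely defined, closed, linear operator with $A^*A\geq\varepsilon I_{\mathcal{H}_1}$ for some $\varepsilon>0$, and let $R$ be a densely defined, closable operator in $\mathcal{H}_1$ with $\operatorname{dom}(R)\supseteq\operatorname{dom}(A)$. Then $$Q_{A,R}\big(I_{\mathcal{H}_1}\oplus[I_{\mathcal{H}_2}-P_{\ker(A^* )}]\big)=U_{\widetilde A}\,i\,G_{A,R}\,U_{\widetilde A}^{-1},$$ where the left-hand side is regarded as an operator in $\mathcal{H}_1\oplus\mathcal{K}_A$ (equality including domains).
   Context: $P_{\mathcal{M}}$ denotes the orthogonal projection onto a closed subspace $\mathcal{M}$. Under the hypothesis $A^*A\ge\varepsilon I_{\mathcal{H}_1}$: - $\mathcal{H}_A$ is the Hilbert space $\operatorname{dom}(A)$ with scalar product $(f,g)_A=(Af,Ag)_{\mathcal{H}_2}$. - $\mathcal{K}_A=\operatorname{ran}(A)$, which is a closed subspace of $\mathcal{H}_2$ equal to $\ker(A^* )^\perp$. - $\widetilde A:\mathcal{H}_A\to\mathcal{K}_A$, $f\mapsto Af$, a unitary operator. - $J_A:\mathcal{H}_1\supseteq\operatorname{dom}(A)\to\mathcal{H}_A$, $f\mapsto f$. - $U_{\widetilde A}=\begin{pmatrix}0&I_{\mathcal{H}_1}\\-i\widetilde A&0\end{pmatrix}:\mathcal{H}_A\oplus\mathcal{H}_1\to\mathcal{H}_1\oplus\mathcal{K}_A$,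 a unitary operator. - $G_{A,R}=\begin{pmatrix}0&J_A\\-A^*\widetilde A&-R\end{pmatrix}$ in $\mathcal{H}_A\oplus\mathcal{H}_1$ with $\operatorname{dom}(G_{A,R})=\operatorname{dom}(A^*\widetilde A)\oplus\operatorname{dom}(A)$, where $\operatorname{dom}(A^*\widetilde A)=\{f\in\mathcal{H}_A:\widetilde Af\in\operatorname{dom}(A^* )\}$. - $Q_{A,R}=\begin{pmatrix}-iR&A^*\\ A&0\end{pmatrix}$ in $\mathcal{H}_1\oplus\mathcal{H}_2$ with $\operatorname{dom}(Q_{A,R})=\operatorname{dom}(A)\oplus\operatorname{dom}(A^* )$. The operator $Q_{A,R}(I_{\mathcal{H}_1}\oplus[I_{\mathcal{H}_2}-P_{\ker(A^* )}])$ regarded in $\mathcal{H}_1\oplus\mathcal{K}_A$ is $(f,g)\mapsto(-iRf+A^*g,Af)$ on $\operatorname{dom}(A)\oplus(\operatorname{dom}(A^* )\cap\mathcal{K}_A)$. *)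

theory Defs
  imports "HOL-Analysis.Analysis"
begin

section \<open>Complex Hilbert spaces\<close>

text \<open>
  A complex Hilbert space is a complete real inner product space carrying a compatible complex
  structure: the real scalar multiplication is the restriction of the complex one, and the real
  inner product is the real part of the complex one. Norm and topology are those of the underlying
  real space; positive definiteness of the complex scalar product is inherited from it. The scalar
  product is linear in the second argument.
\<close>

class chilbert_space = real_inner + complete_space +
  fixes scaleC :: "complex \<Rightarrow> 'a \<Rightarrow> 'a" (infixr "*\<^sub>C" 75)
    and cinner :: "'a \<Rightarrow> 'a \<Rightarrow> complex"
  assumes scaleC_add_right: "c *\<^sub>C (x + y) = c *\<^sub>C x + c *\<^sub>C y"
    and scaleC_add_left: "(c + d) *\<^sub>C x = c *\<^sub>C x + d *\<^sub>C x"
    and scaleC_scaleC: "c *\<^sub>C (d *\<^sub>C x) = (c * d) *\<^sub>C x"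
    and scaleR_scaleC: "r *\<^sub>R x = complex_of_real r *\<^sub>C x"
    and cinner_commute: "cinner x y = cnj (cinner y x)"
    and cinner_add_right: "cinner x (y + z) = cinner x y + cinner x z"
    and cinner_scaleC_right: "cinner x (c *\<^sub>C y) = c * cinner x y"
    and inner_eq_Re_cinner: "inner x y = Re (cinner x y)"

instantiation prod :: (chilbert_space, chilbert_space) chilbert_space
begin

definition scaleC_prod_def: "c *\<^sub>C p = (c *\<^sub>C fst p, c *\<^sub>C snd p)"

definition cinner_prod_def: "cinner p q = cinner (fst p) (fst q) + cinner (snd p) (snd q)"

instance
proof
  fix c d :: complex and r :: real and x y z :: "'a \<times> 'b"
  show "c *\<^sub>C (x + y) = c *\<^sub>C x + c *\<^sub>C y"
    by (simp add: scaleC_prod_def scaleC_add_right)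
  show "(c + d) *\<^sub>C x = c *\<^sub>C x + d *\<^sub>C x"
    by (simp add: scaleC_prod_def scaleC_add_left)
  show "c *\<^sub>C (d *\<^sub>C x) = (c * d) *\<^sub>C x"
    by (simp add: scaleC_prod_def scaleC_scaleC)
  show "r *\<^sub>R x = complex_of_real r *\<^sub>C x"
    by (simp add: scaleC_prod_def scaleR_prod_def scaleR_scaleC)
  show "cinner x y = cnj (cinner y x)"
    unfolding cinner_prod_def complex_cnj_add by (metis cinner_commute)
  show "cinner x (y + z) = cinner x y + cinner x z"
    by (simp add: cinner_prod_def cinner_add_right)
  show "cinner x (c *\<^sub>C y) = c * cinner x y"
    by (simp add: cinner_prod_def scaleC_prod_def cinner_scaleC_right distrib_left)
  show "inner x y = Re (cinner x y)"
    by (simp add: cinner_prod_def inner_prod_def inner_eq_Re_cinner)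
qed

end

lemma scaleC_one: "1 *\<^sub>C x = (x :: 'a::chilbert_space)"
  by (metis of_real_1 scaleR_one scaleR_scaleC)

lemma scaleC_zero_right: "c *\<^sub>C 0 = (0 :: 'a::chilbert_space)"
  using scaleC_add_right[of c 0 "0 :: 'a"] by simp


section \<open>Unbounded operators\<close>

text \<open>
  An operator with domain is a partial map, so that \<^term>\<open>dom\<close>, \<^term>\<open>ran\<close>, composition
  \<^term>\<open>(\<circ>\<^sub>m)\<close> (with its natural domain) and extension \<^term>\<open>(\<subseteq>\<^sub>m)\<close> are those of the library,
  and equality of partial maps is equality of operators including their domains.
\<close>

definition linear_op :: "('a::chilbert_space \<rightharpoonup> 'b::chilbert_space) \<Rightarrow> bool" where
  "linear_op T \<longleftrightarrow> T 0 = Some 0 \<and>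
     (\<forall>f g u v. T f = Some u \<longrightarrow> T g = Some v \<longrightarrow> T (f + g) = Some (u + v)) \<and>
     (\<forall>c f u. T f = Some u \<longrightarrow> T (c *\<^sub>C f) = Some (c *\<^sub>C u))"

definition densely_defined :: "('a::chilbert_space \<rightharpoonup> 'b::chilbert_space) \<Rightarrow> bool" where
  "densely_defined T \<longleftrightarrow> closure (dom T) = UNIV"

definition closed_op :: "('a::chilbert_space \<rightharpoonup> 'b::chilbert_space) \<Rightarrow> bool" where
  "closed_op T \<longleftrightarrow> closed (Map.graph T)"

definition closable_op :: "('a::chilbert_space \<rightharpoonup> 'b::chilbert_space) \<Rightarrow> bool" where
  "closable_op T \<longleftrightarrow> (\<exists>S. linear_op S \<and> closed_op S \<and> T \<subseteq>\<^sub>m S)"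

definition ker_op :: "('a::chilbert_space \<rightharpoonup> 'b::chilbert_space) \<Rightarrow> 'a set" where
  "ker_op T = {f. T f = Some 0}"

text \<open>The \<open>h\<close> below is unique when \<open>T\<close> is densely defined.\<close>

definition adj :: "('a::chilbert_space \<rightharpoonup> 'b::chilbert_space) \<Rightarrow> ('b \<rightharpoonup> 'a)" where
  "adj T g =
     (if \<exists>h. \<forall>f u. T f = Some u \<longrightarrow> cinner g u = cinner h f
      then Some (THE h. \<forall>f u. T f = Some u \<longrightarrow> cinner g u = cinner h f) else None)"

definition id_op :: "'a::chilbert_space set \<Rightarrow> ('a \<rightharpoonup> 'a)" where
  "id_op D = Some |` D"

definition zero_op :: "'a::chilbert_space set \<Rightarrow> ('a \<rightharpoonup> 'b::chilbert_space)" where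
  "zero_op D = (\<lambda>_. Some 0) |` D"

definition op_add ::
  "('a::chilbert_space \<rightharpoonup> 'b::chilbert_space) \<Rightarrow> ('a \<rightharpoonup> 'b) \<Rightarrow> ('a \<rightharpoonup> 'b)" where
  "op_add S T f = (case (S f, T f) of (Some u, Some v) \<Rightarrow> Some (u + v) | _ \<Rightarrow> None)"

definition op_scale ::
  "complex \<Rightarrow> ('a::chilbert_space \<rightharpoonup> 'b::chilbert_space) \<Rightarrow> ('a \<rightharpoonup> 'b)" where
  "op_scale c T f = map_option (\<lambda>u. c *\<^sub>C u) (T f)"

definition op_diff ::
  "('a::chilbert_space \<rightharpoonup> 'b::chilbert_space) \<Rightarrow> ('a \<rightharpoonup> 'b) \<Rightarrow> ('a \<rightharpoonup> 'b)" where
  "op_diff S T = op_add S (op_scale (-1) T)"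

definition op_inv :: "('a::chilbert_space \<rightharpoonup> 'b::chilbert_space) \<Rightarrow> ('b \<rightharpoonup> 'a)" where
  "op_inv T u = (if \<exists>f. T f = Some u then Some (THE f. T f = Some u) else None)"

text \<open>
  The operator given by the block matrix with rows \<open>(S11, S12)\<close> and \<open>(S21, S22)\<close>, on the
  natural domain \<open>(dom S11 \<inter> dom S21) \<times> (dom S12 \<inter> dom S22)\<close>.
\<close>

definition block_op ::
  "('a::chilbert_space \<rightharpoonup> 'c::chilbert_space) \<Rightarrow> ('b::chilbert_space \<rightharpoonup> 'c) \<Rightarrow>
   ('a \<rightharpoonup> 'd::chilbert_space) \<Rightarrow> ('b \<rightharpoonup> 'd) \<Rightarrow> ('a \<times> 'b \<rightharpoonup> 'c \<times> 'd)" where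
  "block_op S11 S12 S21 S22 = (\<lambda>(f, g).
     case (S11 f, S12 g, S21 f, S22 g) of
       (Some u11, Some u12, Some u21, Some u22) \<Rightarrow> Some (u11 + u12, u21 + u22)
     | _ \<Rightarrow> None)"

definition diag_op ::
  "('a::chilbert_space \<rightharpoonup> 'c::chilbert_space) \<Rightarrow> ('b::chilbert_space \<rightharpoonup> 'd::chilbert_space) \<Rightarrow>
   ('a \<times> 'b \<rightharpoonup> 'c \<times> 'd)" where
  "diag_op S T = block_op S (zero_op UNIV) (zero_op UNIV) T"

text \<open>
  \<open>S \<ge> c I\<close> in the sense of quadratic forms on \<open>dom S\<close>: \<open>(f, S f)\<close> is real and at least
  \<open>c \<parallel>f\<parallel>\<^sup>2\<close> for all \<open>f\<close> in the domain of \<open>S\<close>.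
\<close>

definition op_ge_scalar :: "('a::chilbert_space \<rightharpoonup> 'a) \<Rightarrow> real \<Rightarrow> bool" where
  "op_ge_scalar S c \<longleftrightarrow>
     (\<forall>f u. S f = Some u \<longrightarrow> Im (cinner f u) = 0 \<and> c * (norm f)\<^sup>2 \<le> Re (cinner f u))"

text \<open>Orthogonal projection onto a closed subspace \<open>M\<close>, an everywhere defined operator.\<close>

definition proj :: "'a::chilbert_space set \<Rightarrow> ('a \<rightharpoonup> 'a)" where
  "proj M x = Some (THE y. y \<in> M \<and> (\<forall>z\<in>M. cinner z (x - y) = 0))"


section \<open>The spaces and operators associated with \<open>A\<close> and \<open>R\<close>\<close>

text \<open>
  Spaces such as \<open>\<H>\<^sub>A\<close> consist of a linear subspace of an ambient space with a scalar
  product of their own, which need not be the ambient one; likewise the scalar product of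
  \<open>\<H>\<^sub>A \<oplus> \<H>\<^sub>1\<close> is not the one of the product type.
\<close>

record 'a space_ip =
  carr :: "'a set"
  ip :: "'a \<Rightarrow> 'a \<Rightarrow> complex"

definition whole :: "'a::chilbert_space space_ip" where
  "whole = \<lparr>carr = UNIV, ip = cinner\<rparr>"

definition dir_sum :: "'a space_ip \<Rightarrow> 'b space_ip \<Rightarrow> ('a \<times> 'b) space_ip" where
  "dir_sum H K = \<lparr>carr = carr H \<times> carr K,
     ip = (\<lambda>p q. ip H (fst p) (fst q) + ip K (snd p) (snd q))\<rparr>"

definition unitary_op ::
  "'a::chilbert_space space_ip \<Rightarrow> 'b::chilbert_space space_ip \<Rightarrow> ('a \<rightharpoonup> 'b) \<Rightarrow> bool" where
  "unitary_op H K U \<longleftrightarrow> linear_op U \<and> dom U = carr H \<and> ran U = carr K \<and>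
     (\<forall>f g u v. U f = Some u \<longrightarrow> U g = Some v \<longrightarrow> ip K u v = ip H f g)"

definition H_A :: "('a::chilbert_space \<rightharpoonup> 'b::chilbert_space) \<Rightarrow> 'a space_ip" where
  "H_A A = \<lparr>carr = dom A, ip = (\<lambda>f g. cinner (the (A f)) (the (A g)))\<rparr>"

definition K_A :: "('a::chilbert_space \<rightharpoonup> 'b::chilbert_space) \<Rightarrow> 'b space_ip" where
  "K_A A = \<lparr>carr = ran A, ip = cinner\<rparr>"

text \<open>
  As partial maps, \<open>A_tilde A\<close> is \<open>A\<close> and \<open>J_A A\<close> is the identity on \<open>dom A\<close>; only the spaces
  between which they act (\<open>\<H>\<^sub>A \<rightarrow> \<K>\<^sub>A\<close> and \<open>\<H>\<^sub>1 \<rightarrow> \<H>\<^sub>A\<close>) are different.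
\<close>

definition A_tilde :: "('a::chilbert_space \<rightharpoonup> 'b::chilbert_space) \<Rightarrow> ('a \<rightharpoonup> 'b)" where
  "A_tilde A = A |` carr (H_A A)"

definition J_A :: "('a::chilbert_space \<rightharpoonup> 'b::chilbert_space) \<Rightarrow> ('a \<rightharpoonup> 'a)" where
  "J_A A = id_op (dom A)"

definition U_tilde ::
  "('a::chilbert_space \<rightharpoonup> 'b::chilbert_space) \<Rightarrow> ('a \<times> 'a \<rightharpoonup> 'a \<times> 'b)" where
  "U_tilde A =
     block_op (zero_op (carr (H_A A)))         (id_op UNIV)
              (op_scale (- \<i>) (A_tilde A))   (zero_op UNIV)"

definition G_op ::
  "('a::chilbert_space \<rightharpoonup> 'b::chilbert_space) \<Rightarrow> ('a \<rightharpoonup> 'a) \<Rightarrow> ('a \<times> 'a \<rightharpoonup> 'a \<times> 'a)" where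
  "G_op A R =
     block_op (zero_op (carr (H_A A)))                       (J_A A)
              (op_scale (- 1) (adj A \<circ>\<^sub>m A_tilde A))   (op_scale (- 1) R)"

definition Q_op ::
  "('a::chilbert_space \<rightharpoonup> 'b::chilbert_space) \<Rightarrow> ('a \<rightharpoonup> 'a) \<Rightarrow> ('a \<times> 'b \<rightharpoonup> 'a \<times> 'b)" where
  "Q_op A R =
     block_op (op_scale (- \<i>) R)   (adj A)
              A                        (zero_op UNIV)"

text \<open>
  The natural domains of the block matrices are the expected ones, and \<open>A_tilde A\<close> and
  \<open>U_tilde A\<close> are unitary between the spaces above.
\<close>

lemma dom_block_op:
  "dom (block_op S11 S12 S21 S22) = (dom S11 \<inter> dom S21) \<times> (dom S12 \<inter> dom S22)"
  by (auto simp: block_op_def dom_def split: option.splits)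

lemma dom_op_scale: "dom (op_scale c T) = dom T"
  by (auto simp: op_scale_def dom_def)

lemma dom_zero_op: "dom (zero_op D) = D"
  by (auto simp: zero_op_def)

lemma dom_id_op: "dom (id_op D) = D"
  by (auto simp: id_op_def)

lemma A_tilde_eq: "A_tilde A = A"
  by (auto simp: A_tilde_def H_A_def restrict_map_def fun_eq_iff domIff)

lemma dom_Q_op:
  assumes "dom A \<subseteq> dom R"
  shows "dom (Q_op A R) = dom A \<times> dom (adj A)"
  using assms by (auto simp: Q_op_def dom_block_op dom_op_scale dom_zero_op)

lemma dom_G_op:
  assumes "dom A \<subseteq> dom R"
  shows "dom (G_op A R) = {f \<in> dom A. the (A f) \<in> dom (adj A)} \<times> dom A"
proof -
  have "dom A \<inter> dom (adj A \<circ>\<^sub>m A) = {f \<in> dom A. the (A f) \<in> dom (adj A)}"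
    by (auto simp: map_comp_def dom_def split: option.splits)
  then show ?thesis
    using assms
    by (auto simp: G_op_def dom_block_op dom_op_scale dom_zero_op J_A_def dom_id_op
        A_tilde_eq H_A_def)
qed

lemma A_tilde_unitary:
  assumes "linear_op A"
  shows "unitary_op (H_A A) (K_A A) (A_tilde A)"
  using assms by (auto simp: unitary_op_def A_tilde_eq H_A_def K_A_def)

lemma U_tilde_eq_Some_iff:
  "U_tilde A (f, g) = Some p \<longleftrightarrow> (\<exists>u. A f = Some u \<and> p = (g, (- \<i>) *\<^sub>C u))"
  by (auto simp: U_tilde_def block_op_def zero_op_def id_op_def op_scale_def A_tilde_eq
      H_A_def restrict_map_def split: option.splits)

lemma U_tilde_unitary:
  assumes lin: "linear_op A"
  shows "unitary_op (dir_sum (H_A A) whole) (dir_sum whole (K_A A)) (U_tilde A)"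
proof -
  have scale: "A (c *\<^sub>C f) = Some (c *\<^sub>C u)" if "A f = Some u" for c f u
    using lin that by (auto simp: linear_op_def)
  have "U_tilde A 0 = Some 0"
    using lin
    by (auto simp: zero_prod_def U_tilde_eq_Some_iff linear_op_def scaleC_zero_right)
  moreover have "U_tilde A (p + q) = Some (u + v)"
    if "U_tilde A p = Some u" "U_tilde A q = Some v" for p q u v
    using lin that
    by (cases p; cases q) (auto simp: U_tilde_eq_Some_iff linear_op_def scaleC_add_right)
  moreover have "U_tilde A (c *\<^sub>C p) = Some (c *\<^sub>C u)" if "U_tilde A p = Some u" for c p u
    using that scale
    by (cases p) (auto simp: scaleC_prod_def U_tilde_eq_Some_iff scaleC_scaleC mult.commute)
  moreover have "dom (U_tilde A) = carr (dir_sum (H_A A) whole)"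
    by (auto simp: dir_sum_def H_A_def whole_def U_tilde_eq_Some_iff dom_def)
  moreover have "ran (U_tilde A) = carr (dir_sum whole (K_A A))"
  proof -
    have "\<exists>p. U_tilde A p = Some (g, u)" if "A f = Some u" for f g u
      using scale[OF that, of \<i>]
      by (intro exI[of _ "(\<i> *\<^sub>C f, g)"])
        (simp add: U_tilde_eq_Some_iff scaleC_scaleC scaleC_one)
    moreover have "\<exists>f. A f = Some ((- \<i>) *\<^sub>C u)" if "A f = Some u" for f u
      using scale[OF that] by blast
    ultimately show ?thesis
      by (fastforce simp: dir_sum_def K_A_def whole_def ran_def U_tilde_eq_Some_iff)
  qed
  moreover have "ip (dir_sum whole (K_A A)) u v = ip (dir_sum (H_A A) whole) p q"
    if "U_tilde A p = Some u" "U_tilde A q = Some v" for p q u v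
  proof -
    have "cinner ((- \<i>) *\<^sub>C a) ((- \<i>) *\<^sub>C b) = cinner a b" for a b :: 'b
      by (subst cinner_scaleC_right, subst cinner_commute, subst cinner_scaleC_right)
        (simp add: cinner_commute[of a b])
    then show ?thesis
      using that
      by (cases p; cases q)
        (auto simp: dir_sum_def K_A_def H_A_def whole_def U_tilde_eq_Some_iff)
  qed
  ultimately show ?thesis
    unfolding unitary_op_def linear_op_def by blast
qed

end

theory Submission
  imports Defs
begin

text \<open>
  Since \<open>A\<^sup>*A \<ge> \<epsilon>\<close>, the operator \<open>A\<close> is injective, so \<open>U\<close> is invertible on its range: if
  \<open>A k = g\<close>, then \<open>U\<inverse> (f, g) = (\<i> k, f)\<close>. The projection onto \<open>ker A\<^sup>*\<close> vanishes on
  \<open>ran A\<close>, so the left-hand side is \<open>Q (f, g)\<close>, and both sides send \<open>(f, g)\<close> to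
  \<open>(- \<i> R f + A\<^sup>* g, A f)\<close>. The domains agree because \<open>dom A\<^sup>*\<close> is invariant under
  multiplication by \<open>\<i>\<close>.
\<close>

lemma cinner_scaleC_left: "cinner (c *\<^sub>C x) y = cnj c * cinner x (y :: 'a::chilbert_space)"
  by (metis cinner_commute cinner_scaleC_right complex_cnj_mult)

lemma scaleC_zero_left: "0 *\<^sub>C x = (0 :: 'a::chilbert_space)"
  using scaleC_add_left[of 0 0 x] by simp

lemma scaleC_minus1_left: "(- 1) *\<^sub>C x = - (x :: 'a::chilbert_space)"
  using scaleR_scaleC[of "-1" x] by simp

lemma cinner_zero_left: "cinner 0 (x :: 'a::chilbert_space) = 0"
  using cinner_scaleC_left[of 0 0 x] by (simp add: scaleC_zero_left)

lemma cinner_zero_right: "cinner (x :: 'a::chilbert_space) 0 = 0"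
  using cinner_scaleC_right[of x 0 0] by (simp add: scaleC_zero_left)

lemma cinner_diff_right:
  "cinner x (y - z) = cinner x y - cinner x (z :: 'a::chilbert_space)"
  using cinner_add_right[of x "y - z" z] by simp

lemma cinner_self_eq_0_iff: "cinner x x = 0 \<longleftrightarrow> x = (0 :: 'a::chilbert_space)"
  using inner_eq_Re_cinner[of x x] by (auto simp: cinner_zero_left)

text \<open>Taking real parts turns the hypothesis into orthogonality of \<open>h - k\<close> to
  \<open>D\<close>. The zero set of the continuous map \<open>inner (h - k)\<close> is closed, hence
  everything, and so contains \<open>h - k\<close> itself.\<close>

lemma eq_if_cinner_eq_on_dense:
  fixes h k :: "'a::chilbert_space"
  assumes "closure D = UNIV" and "\<And>f. f \<in> D \<Longrightarrow> cinner h f = cinner k f"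
  shows "h = k"
proof -
  have "D \<subseteq> {f. inner (h - k) f = 0}"
    using assms(2) by (simp add: subset_iff inner_diff_left) (simp add: inner_eq_Re_cinner)
  moreover have "closed {f. inner (h - k) f = 0}"
    by (intro closed_Collect_eq continuous_intros)
  ultimately have "closure D \<subseteq> {f. inner (h - k) f = 0}"
    by (rule closure_minimal)
  then have "h - k \<in> {f. inner (h - k) f = 0}"
    unfolding assms(1) by (rule subsetD) simp
  then show ?thesis by simp
qed

text \<open>Density of the domain makes the representing vector unique, which eliminates the
  \<open>THE\<close> in \<open>adj\<close>. All later facts on the adjoint go through this
  form.\<close>

lemma adj_eq_Some_iff:
  assumes "densely_defined T"
  shows "adj T g = Some h \<longleftrightarrow> (\<forall>f u. T f = Some u \<longrightarrow> cinner g u = cinner h f)"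
proof -
  have unique: "h' = k"
    if h': "\<forall>f u. T f = Some u \<longrightarrow> cinner g u = cinner h' f"
      and k: "\<forall>f u. T f = Some u \<longrightarrow> cinner g u = cinner k f" for h' k
  proof (rule eq_if_cinner_eq_on_dense)
    show "closure (dom T) = UNIV"
      using assms by (simp add: densely_defined_def)
    fix f assume "f \<in> dom T"
    then obtain u where "T f = Some u" by blast
    with h' k have "cinner g u = cinner h' f" "cinner g u = cinner k f" by blast+
    then show "cinner h' f = cinner k f" by simp
  qed
  show ?thesis
  proof
    assume adj: "adj T g = Some h"
    then obtain k where k: "\<forall>f u. T f = Some u \<longrightarrow> cinner g u = cinner k f"
      by (auto simp: adj_def split: if_splits)
    then have "(THE k. \<forall>f u. T f = Some u \<longrightarrow> cinner g u = cinner k f) = k"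
      using unique[OF _ k] by (rule the_equality)
    with adj k have "h = k"
      by (auto simp: adj_def split: if_splits)
    with k show "\<forall>f u. T f = Some u \<longrightarrow> cinner g u = cinner h f"
      by simp
  next
    assume h: "\<forall>f u. T f = Some u \<longrightarrow> cinner g u = cinner h f"
    then have "(THE k. \<forall>f u. T f = Some u \<longrightarrow> cinner g u = cinner k f) = h"
      using unique[OF _ h] by (rule the_equality)
    with h show "adj T g = Some h"
      by (auto simp: adj_def)
  qed
qed

text \<open>Both sides of the adjoint relation are antilinear in the vectors concerned, so the
  factor \<open>cnj c\<close> appears on each. The equality includes definedness, and there
  \<open>c\<close> must be invertible: \<open>adj T 0\<close> is always defined.\<close>

lemma adj_scaleC:
  assumes T: "densely_defined T" and "c \<noteq> 0"
  shows "adj T (c *\<^sub>C g) = map_option ((*\<^sub>C) c) (adj T g)"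
proof -
  have *: "adj T (d *\<^sub>C g') = Some (d *\<^sub>C h)" if "adj T g' = Some h" for d g' h
    using that by (simp add: adj_eq_Some_iff[OF T] cinner_scaleC_left)
  show ?thesis
  proof (cases "adj T g")
    case None
    \<comment> \<open>Scaling by \<open>inverse c\<close> would carry a value at the multiple back
      to a value at \<open>g\<close>.\<close>
    have "adj T (c *\<^sub>C g) = None"
    proof (rule ccontr)
      assume "adj T (c *\<^sub>C g) \<noteq> None"
      then obtain h where "adj T (c *\<^sub>C g) = Some h" by blast
      from *[OF this, of "inverse c"] show False
        using None \<open>c \<noteq> 0\<close> by (simp add: scaleC_scaleC scaleC_one)
    qed
    with None show ?thesis by simp
  qed (simp add: *)
qed

text \<open>Vectors of \<open>ran T\<close> are orthogonal to the kernel of the adjoint, so 0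
  satisfies the condition that defines \<open>proj\<close>.\<close>

lemma proj_ker_adj_ran:
  assumes T: "densely_defined T" and g: "g \<in> ran T"
  shows "proj (ker_op (adj T)) g = Some 0"
proof -
  have orth: "cinner z g = 0" if "z \<in> ker_op (adj T)" for z
    using that g by (auto simp: ker_op_def adj_eq_Some_iff[OF T] cinner_zero_left ran_def)
  have "(THE y. y \<in> ker_op (adj T) \<and> (\<forall>z\<in>ker_op (adj T). cinner z (g - y) = 0)) = 0"
  proof (rule the_equality)
    have "0 \<in> ker_op (adj T)"
      by (simp add: ker_op_def adj_eq_Some_iff[OF T] cinner_zero_left)
    then show "0 \<in> ker_op (adj T) \<and> (\<forall>z\<in>ker_op (adj T). cinner z (g - 0) = 0)"
      by (simp add: orth)
  next
    fix y
    assume "y \<in> ker_op (adj T) \<and> (\<forall>z\<in>ker_op (adj T). cinner z (g - y) = 0)"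
    \<comment> \<open>Test the orthogonality with \<open>z = y\<close>; the term
      \<open>cinner y g\<close> vanishes by \<open>orth\<close>.\<close>
    then have "cinner y y = 0"
      by (simp add: cinner_diff_right orth)
    then show "y = 0" by (simp add: cinner_self_eq_0_iff)
  qed
  then show ?thesis by (simp add: proj_def)
qed

text \<open>The adjoint is defined at 0, so a kernel vector of \<open>T\<close> lies in the domain
  of the composition, where the form bound forces its norm to be 0.\<close>

lemma ker_trivial_if_adj_comp_ge:
  assumes T: "densely_defined T" and "\<epsilon> > 0" and ge: "op_ge_scalar (adj T \<circ>\<^sub>m T) \<epsilon>"
  shows "ker_op T \<subseteq> {0}"
proof
  fix f assume "f \<in> ker_op T"
  then have "T f = Some 0" by (simp add: ker_op_def)
  then have "(adj T \<circ>\<^sub>m T) f = Some 0"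
    by (simp add: adj_eq_Some_iff[OF T] cinner_zero_left)
  with ge have "\<epsilon> * (norm f)\<^sup>2 \<le> Re (cinner f 0)"
    unfolding op_ge_scalar_def by blast
  with \<open>\<epsilon> > 0\<close> show "f \<in> {0}"
    by (simp add: cinner_zero_right mult_le_0_iff)
qed

lemma linear_op_inj:
  assumes T: "linear_op T" and ker: "ker_op T \<subseteq> {0}"
    and f: "T f = Some u" and g: "T g = Some u"
  shows "f = g"
proof -
  have "T ((- 1) *\<^sub>C g) = Some ((- 1) *\<^sub>C u)"
    using T g unfolding linear_op_def by blast
  with T f have "T (f + (- 1) *\<^sub>C g) = Some (u + (- 1) *\<^sub>C u)"
    unfolding linear_op_def by blast
  then have "f - g \<in> ker_op T"
    by (simp add: scaleC_minus1_left ker_op_def)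
  with ker show ?thesis by auto
qed

lemma op_inv_eq_Some:
  assumes "T f = Some u" and "\<And>g. T g = Some u \<Longrightarrow> g = f"
  shows "op_inv T u = Some f"
proof -
  have "(THE g. T g = Some u) = f"
    using assms by (rule the_equality)
  moreover have "\<exists>g. T g = Some u"
    using assms(1) by (rule exI)
  ultimately show ?thesis by (simp add: op_inv_def)
qed

text \<open>Solving \<open>- \<i> A k' = g\<close> gives \<open>k' = \<i> k\<close>; injectivity of
  \<open>A\<close> makes this the only solution, as the \<open>THE\<close> in \<open>op_inv\<close>
  requires.\<close>

lemma op_inv_U_tilde:
  assumes A: "linear_op A" and ker: "ker_op A \<subseteq> {0}" and k: "A k = Some g"
  shows "op_inv (U_tilde A) (f, g) = Some (\<i> *\<^sub>C k, f)"
proof (rule op_inv_eq_Some)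
  have ik: "A (\<i> *\<^sub>C k) = Some (\<i> *\<^sub>C g)"
    using A k by (simp add: linear_op_def)
  then show "U_tilde A (\<i> *\<^sub>C k, f) = Some (f, g)"
    by (simp add: U_tilde_eq_Some_iff scaleC_scaleC scaleC_one)
  fix p assume "U_tilde A p = Some (f, g)"
  then obtain k' u where p: "p = (k', f)" and u: "A k' = Some u" "g = (- \<i>) *\<^sub>C u"
    by (cases p) (auto simp: U_tilde_eq_Some_iff)
  from u have "A k' = Some (\<i> *\<^sub>C g)"
    by (simp add: scaleC_scaleC scaleC_one)
  from linear_op_inj[OF A ker this ik] p show "p = (\<i> *\<^sub>C k, f)"
    by simp
qed

text \<open>With \<open>h\<close> and \<open>r\<close> the values of \<open>adj A g\<close> and
  \<open>R f\<close>, the operator \<open>\<i> G\<close> sends \<open>(\<i> k, f)\<close> to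
  \<open>(\<i> f, h - \<i> r)\<close>, and the factor \<open>- \<i>\<close> in
  \<open>U_tilde\<close> then turns \<open>A (\<i> f)\<close> back into \<open>A f\<close>.\<close>

lemma U_tilde_G_op:
  assumes A: "linear_op A" "densely_defined A" and dom: "dom A \<subseteq> dom R"
    and k: "A k = Some g"
  shows "(U_tilde A \<circ>\<^sub>m op_scale \<i> (G_op A R)) (\<i> *\<^sub>C k, f) = Q_op A R (f, g)"
proof -
  have scale: "A (c *\<^sub>C f') = Some (c *\<^sub>C u)" if "A f' = Some u" for c f' u
    using A(1) that by (simp add: linear_op_def)
  have adj: "adj A (\<i> *\<^sub>C g) = map_option ((*\<^sub>C) \<i>) (adj A g)"
    by (simp add: adj_scaleC[OF A(2)])
  show ?thesis
  proof (cases "A f")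
    \<comment> \<open>Both sides are undefined: \<open>J_A\<close> fails at \<open>f\<close> inside
      \<open>G_op\<close>, and the entry \<open>A\<close> fails inside \<open>Q_op\<close>.\<close>
    case None
    then show ?thesis
      by (auto simp: map_comp_def Q_op_def G_op_def block_op_def op_scale_def J_A_def id_op_def
          restrict_map_def split: option.splits)
  next
    case (Some v)
    \<comment> \<open>From here on only \<open>adj A g\<close> decides whether either side is
      defined.\<close>
    then obtain r where r: "R f = Some r" using dom by blast
    have G: "G_op A R (\<i> *\<^sub>C k, f) =
        map_option (\<lambda>h. (f, (- 1) *\<^sub>C \<i> *\<^sub>C h + (- 1) *\<^sub>C r)) (adj A g)"
      using Some r scale[OF k] by (auto simp: G_op_def block_op_def op_scale_def J_A_def
          id_op_def zero_op_def H_A_def A_tilde_eq map_comp_def adj restrict_map_def domIff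
          split: option.splits)
    have Q: "Q_op A R (f, g) = map_option (\<lambda>h. ((- \<i>) *\<^sub>C r + h, v)) (adj A g)"
      using Some r by (auto simp: Q_op_def block_op_def op_scale_def zero_op_def
          split: option.splits)
    show ?thesis
    proof (cases "adj A g")
      case None
      then show ?thesis by (simp add: G Q op_scale_def)
    next
      case (Some h)
      then show ?thesis
        using scale[OF \<open>A f = Some v\<close>, of \<i>]
        by (simp add: G Q op_scale_def scaleC_prod_def U_tilde_eq_Some_iff scaleC_add_right
            scaleC_scaleC scaleC_one)
    qed
  qed
qed

theorem theorem4p5:
  fixes A :: "'a::chilbert_space \<rightharpoonup> 'b::chilbert_space"
    and R :: "'a \<rightharpoonup> 'a"
    and \<epsilon> :: real
  assumes "separable_space (euclidean :: 'a topology)"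
    and "separable_space (euclidean :: 'b topology)"
    and "linear_op A" and "densely_defined A" and "closed_op A"
    and "\<epsilon> > 0" and "op_ge_scalar (adj A \<circ>\<^sub>m A) \<epsilon>"
    and "linear_op R" and "densely_defined R" and "closable_op R"
    and "dom A \<subseteq> dom R"
  shows "(Q_op A R \<circ>\<^sub>m
            diag_op (id_op UNIV) (op_diff (id_op UNIV) (proj (ker_op (adj A)))))
           |` carr (dir_sum whole (K_A A))
         = U_tilde A \<circ>\<^sub>m op_scale \<i> (G_op A R) \<circ>\<^sub>m op_inv (U_tilde A)"
proof
  fix x :: "'a \<times> 'b"
  obtain f g where x: "x = (f, g)" by fastforce
  show "((Q_op A R \<circ>\<^sub>m
            diag_op (id_op UNIV) (op_diff (id_op UNIV) (proj (ker_op (adj A)))))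
           |` carr (dir_sum whole (K_A A))) x
         = (U_tilde A \<circ>\<^sub>m op_scale \<i> (G_op A R) \<circ>\<^sub>m op_inv (U_tilde A)) x"
    (is "(?L |` ?D) x = ?r")
  proof (cases "g \<in> ran A")
    case True
    then obtain k where k: "A k = Some g" by (auto simp: ran_def)
    \<comment> \<open>The projection of \<open>g\<close> is 0, so the diagonal operator fixes
      \<open>(f, g)\<close>.\<close>
    have "(?L |` ?D) x = Q_op A R (f, g)"
      using True by (simp add: x dir_sum_def whole_def K_A_def diag_op_def block_op_def
          id_op_def zero_op_def op_diff_def op_add_def op_scale_def scaleC_zero_right
          proj_ker_adj_ran[OF assms(4) True])
    also have "\<dots> = (U_tilde A \<circ>\<^sub>m op_scale \<i> (G_op A R)) (\<i> *\<^sub>C k, f)"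
      by (rule U_tilde_G_op[OF assms(3,4,11) k, symmetric])
    also have "\<dots> = ?r"
      using op_inv_U_tilde[OF assms(3) ker_trivial_if_adj_comp_ge[OF assms(4,6,7)] k]
      by (simp add: x map_comp_def)
    finally show ?thesis .
  next
    case False
    \<comment> \<open>Outside \<open>ran A\<close> the restriction makes the left side undefined; on
      the right \<open>op_inv\<close> fails because \<open>(f, g)\<close> is not in the range of
      \<open>U_tilde A\<close>.\<close>
    have "U_tilde A p \<noteq> Some (f, g)" for p
    proof
      assume "U_tilde A p = Some (f, g)"
      then have "(f, g) \<in> carr (dir_sum whole (K_A A))"
        using U_tilde_unitary[OF assms(3)] by (metis ranI unitary_op_def)
      with False show False by (simp add: dir_sum_def K_A_def)
    qed
    then have "op_inv (U_tilde A) x = None" by (simp add: x op_inv_def)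
    with False show ?thesis
      by (simp add: x dir_sum_def K_A_def map_comp_def)
  qed
qed

end
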